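(* Let $K>1$, $\theta\in(-\pi/2,\pi/2]$ and $c\in\mathbb{C}\setminus\mathcal{M}_{K,\theta}$, and let $H_{K,\theta,c}(z)=\left[\left(\frac{K+1}{2}\right)z+e^{2i\theta}\left(\frac{K-1}{2}\right)\overline{z}\right]^2+c$. Suppose there exists $n\in\mathbb{N}$ such that $H_{K,\theta,c}$ has at least $2^n+1$ periodic points of period $n$. Then $\partial I(H_{K,\theta,c})$ is not a Cantor set.
   Context: For a map $f:\mathbb{C}\to\mathbb{C}$, $f^n$ denotes the $n$-th iterate. The escaping set is $I(f)=\{z\in\mathbb{C}: f^n(z)\to\infty\}$ and the bounded orbit set is $BO(f)=\{z\in\mathbb{C}: \exists M>0 \text{ with } |f^n(z)|\le M \text{ for all } n\in\mathbb{N}\}$. The Mandelbrot set is $\mathcal{M}_{K,\theta}=\{c\in\mathbb{C}: 0\in BO(H_{K,\theta,c})\}$. A periodic point of period $n$ of $f$ is any solution $z\in\mathbb{C}$ of $f^n(z)=z$ (the period need not be minimal; a fixed point is a periodic point of all periods). A Cantor set is a totally disconnected, compact, perfect set. *)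

theory Defs
  imports "HOL-Analysis.Analysis"
begin

definition escaping_set :: "(complex \<Rightarrow> complex) \<Rightarrow> complex set" where
  "escaping_set f = {z. filterlim (\<lambda>n. (f ^^ n) z) at_infinity sequentially}"

definition bounded_orbit_set :: "(complex \<Rightarrow> complex) \<Rightarrow> complex set" where
  "bounded_orbit_set f = {z. \<exists>M>0. \<forall>n. cmod ((f ^^ n) z) \<le> M}"

definition H :: "real \<Rightarrow> real \<Rightarrow> complex \<Rightarrow> complex \<Rightarrow> complex" where
  "H K \<theta> c z =
     (of_real ((K + 1) / 2) * z
      + exp (2 * \<i> * of_real \<theta>) * of_real ((K - 1) / 2) * cnj z)\<^sup>2 + c"

definition mandelbrot_set :: "real \<Rightarrow> real \<Rightarrow> complex set" where
  "mandelbrot_set K \<theta> = {c. 0 \<in> bounded_orbit_set (H K \<theta> c)}"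

(* The period n need not be minimal. For n = 0 the set is all of \<complex>; it is only
   meaningful for n > 0. *)
definition periodic_points :: "(complex \<Rightarrow> complex) \<Rightarrow> nat \<Rightarrow> complex set" where
  "periodic_points f n = {z. (f ^^ n) z = z}"

definition totally_disconnected :: "'a::topological_space set \<Rightarrow> bool" where
  "totally_disconnected S \<longleftrightarrow> (\<forall>x\<in>S. connected_component_set S x = {x})"

definition perfect :: "'a::topological_space set \<Rightarrow> bool" where
  "perfect S \<longleftrightarrow> closed S \<and> (\<forall>x\<in>S. \<not> x isolated_in S)"

(* Nonemptiness is not part of this notion, so {} counts as a Cantor set. *)
definition cantor_set :: "'a::topological_space set \<Rightarrow> bool" where
  "cantor_set S \<longleftrightarrow> totally_disconnected S \<and> compact S \<and> perfect S"

end

theory Submission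
  imports Defs "HOL-Complex_Analysis.Complex_Analysis"
begin

text \<open>Write the map as \<open>F z = (h z)\<^sup>2 + c\<close> with \<open>h\<close> a plane homeomorphism and \<open>cmod (h z) \<ge> cmod z\<close>, and let
  \<open>U n\<close> be the preimage of a large disc under \<open>F ^^ n\<close>. The bounded orbits form \<open>\<Inter>n. U n\<close>. As \<open>0\<close>
  escapes, there is a first \<open>N\<close> with \<open>c \<notin> U N\<close>, and this \<open>U N\<close> is simply connected; a continuous
  square root of \<open>z - c\<close> on it yields two continuous inverse branches of \<open>F\<close> that map \<open>U N\<close> into
  itself, and every bounded orbit has an itinerary in two symbols. Among more than \<open>2 ^ n\<close> periodic
  points of period \<open>n\<close>, two share their itinerary, so both lie in the nested intersection of the
  closures of connected cylinders, a connected set of bounded orbits. If the frontier of the escaping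
  set were totally disconnected, the bounded orbits would have empty interior and thus lie in that
  frontier, a contradiction.\<close>

section \<open>Sets with totally disconnected frontier\<close>

lemma totally_disconnected_connected_subset:
  assumes "totally_disconnected S" "connected T" "T \<subseteq> S" "x \<in> T" "y \<in> T"
  shows "x = y"
proof -
  have "T \<subseteq> connected_component_set S x"
    using assms by (simp add: connected_component_maximal)
  moreover have "connected_component_set S x = {x}"
    using assms unfolding totally_disconnected_def by blast
  ultimately show ?thesis using assms(5) by auto
qed

text \<open>Otherwise take a component \<open>V\<close> of the interior and an unbounded component
  \<open>C\<close> of the complement of its closure. The frontier of \<open>C\<close> is connected
  and lies in \<open>frontier S\<close>, so it has at most one point, and one point cannot separate
  \<open>C\<close> from \<open>V\<close> in dimension at least 2.\<close>

lemma interior_empty_if_totally_disconnected_frontier: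
  fixes S :: "'a::euclidean_space set"
  assumes "bounded S" and td: "totally_disconnected (frontier S)" and dim: "2 \<le> DIM('a)"
  shows "interior S = {}"
proof (rule ccontr)
  assume "interior S \<noteq> {}"
  then obtain V where V: "V \<in> components (interior S)"
    using components_eq_empty by blast
  have V_open: "open V" and V_conn: "connected V" and V_ne: "V \<noteq> {}"
    using V by (auto intro: open_components in_components_connected dest: in_components_nonempty)
  have "bounded V"
    using V assms(1) by (meson bounded_subset in_components_subset interior_subset)
  then obtain C where C: "C \<in> components (- closure V)" and "\<not> bounded C"
    using cobounded_unbounded_components[of "- closure V"] by auto
  have "open C"
    using C by (rule open_components[rotated]) auto
  have "frontier C \<subseteq> frontier (closure V)"
    using frontier_of_components_subset[OF C] by simp
  also have "\<dots> \<subseteq> frontier V"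
    using interior_mono[OF closure_subset[of V]] by (auto simp: frontier_def)
  also have "\<dots> \<subseteq> frontier (interior S)"
    by (rule frontier_of_components_subset[OF V])
  also have "\<dots> \<subseteq> frontier S"
    by (rule frontier_interior_subset)
  finally have sub: "frontier C \<subseteq> frontier S" .
  have "connected (frontier C)"
    using connected_frontier_component_complement[OF connected_imp_connected_closure[OF V_conn] C] .
  then have "x = y" if "x \<in> frontier C" "y \<in> frontier C" for x y
    using totally_disconnected_connected_subset[OF td _ sub] that by blast
  then obtain q where q: "frontier C \<subseteq> {q}"
    by blast
  have not_sing: "\<not> A \<subseteq> {q}" if "open A" "A \<noteq> {}" for A :: "'a set"
    using that by (metis finite.emptyI finite.insertI finite_imp_not_open finite_subset)
  \<comment> \<open>The punctured space is connected and misses \<open>frontier C\<close>, so it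
    lies entirely outside or entirely inside \<open>C\<close>.\<close>
  have "- {q} \<inter> C = {} \<or> - {q} - C = {}"
    using connected_Int_frontier[OF connected_punctured_universe[OF dim], of q C] q by blast
  moreover have "\<not> C \<subseteq> {q}"
    using not_sing[OF \<open>open C\<close>] in_components_nonempty[OF C] by blast
  moreover have "\<not> V \<subseteq> {q}"
    using not_sing[OF V_open V_ne] by blast
  moreover have "C \<inter> V = {}"
    using in_components_subset[OF C] closure_subset by blast
  ultimately show False by blast
qed

text \<open>A path version of "every component is unbounded". Paths on a half-line can be lifted
  through \<open>F\<close>, so this form passes to preimages.\<close>

definition ray_connected_to_infinity :: "complex set \<Rightarrow> bool" where
  "ray_connected_to_infinity E \<longleftrightarrow>
     (\<forall>z\<in>E. \<exists>\<gamma>. continuous_on {0::real..} \<gamma> \<and> \<gamma> 0 = z \<and> \<gamma> ` {0..} \<subseteq> E \<and> \<not> bounded (\<gamma> ` {0..}))"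

lemma ray_connected_to_infinity_components:
  assumes "ray_connected_to_infinity E" "C \<in> components E"
  shows "\<not> bounded C"
proof -
  obtain z where z: "z \<in> E" "C = connected_component_set E z"
    using assms(2) by (auto simp: components_def)
  obtain \<gamma> where \<gamma>: "continuous_on {0::real..} \<gamma>" "\<gamma> 0 = z" "\<gamma> ` {0..} \<subseteq> E" "\<not> bounded (\<gamma> ` {0..})"
    using assms(1) z(1) unfolding ray_connected_to_infinity_def by blast
  have "connected (\<gamma> ` {0..})"
    using \<gamma>(1) by (intro connected_continuous_image) auto
  then have "\<gamma> ` {0..} \<subseteq> C"
    unfolding z(2) using \<gamma> by (intro connected_component_maximal) auto
  then show ?thesis
    using \<gamma>(4) bounded_subset by blast
qed

section \<open>Escape, the sets \<open>U n\<close> and their simple connectivity\<close>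

locale expanding_square =
  fixes h k :: "complex \<Rightarrow> complex" and c :: complex
  assumes cont_h: "continuous_on UNIV h" and cont_k: "continuous_on UNIV k"
    and hk [simp]: "h (k z) = z" and kh [simp]: "k (h z) = z"
    and norm_h: "cmod z \<le> cmod (h z)"
begin

definition F :: "complex \<Rightarrow> complex" where "F z = (h z)\<^sup>2 + c"

text \<open>For \<open>cmod z >= R\<close> this gives
  \<open>cmod (F z) >= R * cmod z - cmod c >= 2 * cmod z\<close>: the summand \<open>cmod c\<close>
  absorbs the translation because \<open>cmod z >= 1\<close>, and the 2 is left as growth
  factor.\<close>

definition R :: real where "R = cmod c + 2"

definition U :: "nat \<Rightarrow> complex set" where "U n = {z. cmod ((F ^^ n) z) < R}"

lemma k_0 [simp]: "k 0 = 0"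
  using norm_h[of "k 0"] by simp

lemma h_0 [simp]: "h 0 = 0"
  using hk[of 0] by simp

lemma F_0 [simp]: "F 0 = c"
  by (simp add: F_def)

lemma continuous_F: "continuous_on S F"
  unfolding F_def by (intro continuous_intros continuous_on_subset[OF cont_h]) auto

lemma continuous_F_funpow: "continuous_on S (F ^^ n)"
proof (induction n arbitrary: S)
  case (Suc n)
  then show ?case
    using continuous_on_compose[OF Suc continuous_F] by (simp add: o_def)
qed (simp add: id_def)

text \<open>\<open>h\<close> is open because its inverse \<open>k\<close> is continuous, and the
  remaining factor is a nonconstant polynomial, open by the open mapping theorem.\<close>

lemma F_open_map:
  assumes "open S"
  shows "open (F ` S)"
proof -
  have "h ` S = k -` S"
  proof
    show "k -` S \<subseteq> h ` S"
      by (metis hk image_iff subsetI vimageE)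
  qed auto
  then have "open (h ` S)"
    using cont_k assms by (simp add: open_vimage)
  moreover have "\<not> (\<lambda>w::complex. w\<^sup>2 + c) constant_on UNIV"
  proof
    assume "(\<lambda>w::complex. w\<^sup>2 + c) constant_on UNIV"
    then have "(0::complex)\<^sup>2 + c = 1\<^sup>2 + c"
      unfolding constant_on_def by (metis UNIV_I)
    then show False by simp
  qed
  ultimately have "open ((\<lambda>w::complex. w\<^sup>2 + c) ` (h ` S))"
    by (intro open_mapping_thm[of "\<lambda>w. w\<^sup>2 + c" UNIV "h ` S"] holomorphic_intros) auto
  then show ?thesis
    by (simp add: F_def image_image cong: image_cong)
qed

lemma norm_F:
  assumes "R \<le> cmod z"
  shows "2 * cmod z \<le> cmod (F z)"
proof -
  have "R * cmod z \<le> (cmod z)\<^sup>2"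
    using assms by (simp add: power2_eq_square mult_right_mono)
  also have "\<dots> \<le> (cmod (h z))\<^sup>2"
    using norm_h by (simp add: power_mono)
  also have "\<dots> \<le> cmod (F z) + cmod c"
    using norm_triangle_ineq4[of "F z" c] by (simp add: F_def norm_power)
  finally have "R * cmod z \<le> cmod (F z) + cmod c" .
  moreover have "cmod c \<le> cmod c * cmod z"
    using assms mult_left_mono[of 1 "cmod z" "cmod c"] norm_ge_zero[of c] unfolding R_def
    by simp
  ultimately show ?thesis
    by (simp add: R_def algebra_simps)
qed

lemma R_pos: "R > 0"
  by (simp add: R_def add_nonneg_pos)

lemma F_grows:
  assumes "R \<le> cmod z"
  shows "cmod z < cmod (F z)"
  using norm_F[OF assms] assms R_pos by linarith

lemma norm_F_funpow:
  assumes "R \<le> cmod z"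
  shows "2 ^ n * cmod z \<le> cmod ((F ^^ n) z)"
proof (induction n)
  case (Suc n)
  have "R \<le> 1 * cmod z" using assms by simp
  also have "\<dots> \<le> 2 ^ n * cmod z"
    by (intro mult_right_mono) auto
  finally have "R \<le> cmod ((F ^^ n) z)"
    using Suc by linarith
  then show ?case
    using norm_F[of "(F ^^ n) z"] Suc by simp
qed simp

lemma U_Suc: "U (Suc n) = F -` U n"
  by (auto simp: U_def funpow_Suc_right simp del: funpow.simps)

lemma open_U: "open (U n)"
  unfolding U_def by (intro open_Collect_less continuous_intros continuous_F_funpow)

text \<open>Outside the disc \<open>F\<close> strictly increases the modulus, so an orbit with
  modulus at most \<open>R\<close> at time \<open>Suc n\<close> has modulus below \<open>R\<close>
  at time \<open>n\<close>.\<close>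

lemma closure_U_Suc: "closure (U (Suc n)) \<subseteq> U n"
proof -
  have "closure (U (Suc n)) \<subseteq> {z. cmod ((F ^^ Suc n) z) \<le> R}"
    by (intro closure_minimal closed_Collect_le continuous_intros continuous_F_funpow)
       (auto simp: U_def)
  also have "\<dots> \<subseteq> U n"
  proof
    fix z assume "z \<in> {z. cmod ((F ^^ Suc n) z) \<le> R}"
    then show "z \<in> U n"
      using F_grows[of "(F ^^ n) z"] by (auto simp: U_def not_less[symmetric])
  qed
  finally show ?thesis .
qed

lemma U_decseq: "m \<le> n \<Longrightarrow> U n \<subseteq> U m"
  by (rule decseqD[OF decseq_SucI]) (use closure_U_Suc closure_subset in blast)+

lemma bounded_U: "bounded (U n)"
proof (rule bounded_subset)
  show "U n \<subseteq> U 0" by (rule U_decseq) simp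
  show "bounded (U 0)"
    unfolding U_def bounded_iff by (auto intro: less_imp_le)
qed

text \<open>A point outside some \<open>U m\<close> at least doubles its modulus at every step from
  time \<open>m\<close> on, so an orbit either stays in the disc of radius \<open>R\<close> or
  escapes.\<close>

lemma bounded_orbit_set_F: "bounded_orbit_set F = (\<Inter>n. U n)"
  and escaping_set_F: "escaping_set F = - bounded_orbit_set F"
proof -
  have esc: "filterlim (\<lambda>n. (F ^^ n) z) at_infinity sequentially" if "z \<notin> U m" for z m
  proof -
    have *: "R \<le> cmod ((F ^^ m) z)" using that by (simp add: U_def)
    have "filterlim (\<lambda>n. 2 ^ n :: real) at_top sequentially"
      by real_asymp
    then have "filterlim (\<lambda>n. 2 ^ n * cmod ((F ^^ m) z)) at_top sequentially"
      using * R_pos by (intro filterlim_at_top_mult_tendsto_pos[OF tendsto_const]) auto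
    then have "filterlim (\<lambda>n. cmod ((F ^^ n) ((F ^^ m) z))) at_top sequentially"
      by (rule filterlim_at_top_mono) (simp add: norm_F_funpow[OF *])
    then have "filterlim (\<lambda>n. (F ^^ n) ((F ^^ m) z)) at_infinity sequentially"
      by (rule filterlim_norm_at_top_imp_at_infinity)
    then have "filterlim (\<lambda>n. (F ^^ (n + m)) z) at_infinity sequentially"
      by (simp add: funpow_add)
    then show ?thesis
      unfolding filterlim_iff
      using eventually_sequentially_seg[of "\<lambda>n. _ ((F ^^ n) z)" m] by blast
  qed
  have not_both: "z \<notin> escaping_set F" if "z \<in> bounded_orbit_set F" for z
  proof
    assume "z \<in> escaping_set F"
    moreover obtain M where M: "M > 0" "\<And>n. cmod ((F ^^ n) z) \<le> M"
      using \<open>z \<in> bounded_orbit_set F\<close> unfolding bounded_orbit_set_def by blast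
    ultimately have "eventually (\<lambda>n. M + 1 \<le> cmod ((F ^^ n) z)) sequentially"
      using filterlim_at_infinity[of 0 "\<lambda>n. (F ^^ n) z" sequentially]
      by (simp add: escaping_set_def)
    then obtain n where "M + 1 \<le> cmod ((F ^^ n) z)"
      using eventually_happens'[OF sequentially_bot] by blast
    with M(2)[of n] show False by simp
  qed
  have sub: "z \<in> bounded_orbit_set F" if "z \<in> (\<Inter>n. U n)" for z
  proof -
    have "\<forall>n. cmod ((F ^^ n) z) \<le> R"
      using that by (auto simp: U_def intro: less_imp_le)
    then show ?thesis
      using R_pos unfolding bounded_orbit_set_def by blast
  qed
  have escaping: "z \<in> escaping_set F" if "z \<notin> (\<Inter>n. U n)" for z
    using that esc by (auto simp: escaping_set_def)
  show "bounded_orbit_set F = (\<Inter>n. U n)"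
    using escaping not_both sub by blast
  show "escaping_set F = - bounded_orbit_set F"
    using escaping not_both sub by blast
qed

text \<open>A component of the preimage maps onto \<open>S\<close>, because \<open>F\<close> is open and proper, and hence contains
  the only preimage \<open>0\<close> of \<open>c\<close>.\<close>

lemma connected_vimage_F:
  assumes "open S" "connected S" "bounded (F -` S)" "c \<in> S"
  shows "connected (F -` S)"
proof -
  have full: "0 \<in> B"
    if AB: "open A" "open B" "A \<inter> B = {}" "A \<union> B = F -` S" "B \<noteq> {}" for A B
  proof -
    have sub: "F ` B \<subseteq> S" using AB by blast
    \<comment> \<open>The image of \<open>B\<close> is relatively closed in \<open>S\<close>: by
      compactness, a limit of values in \<open>S\<close> is the value at a point of
      \<open>closure B\<close>, and the open set \<open>A\<close> contains no such point.\<close>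
    have "S \<inter> closure (F ` B) \<subseteq> F ` B"
    proof
      fix s assume s: "s \<in> S \<inter> closure (F ` B)"
      have "compact (closure B)"
        using assms(3) AB(4) by (metis bounded_subset compact_closure sup_ge2)
      then have "closed (F ` closure B)"
        by (intro compact_imp_closed compact_continuous_image continuous_F)
      then have "closure (F ` B) \<subseteq> F ` closure B"
        by (intro closure_minimal image_mono closure_subset)
      then obtain b where b: "b \<in> closure B" "s = F b" using s by blast
      then have "b \<in> A \<union> B" using s AB(4) by auto
      moreover have "A \<inter> closure B = {}"
        using AB(1,3) by (simp add: open_Int_closure_eq_empty)
      ultimately show "s \<in> F ` B" using b by blast
    qed
    then have "S \<inter> frontier (F ` B) = {}"
      using F_open_map[OF AB(2)] by (auto simp: frontier_def interior_open)
    then have "S \<subseteq> F ` B"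
      using connected_Int_frontier[OF assms(2), of "F ` B"] sub AB(5) by blast
    then obtain b where b: "b \<in> B" "F b = c" using assms(4) by auto
    then have "h b = 0" by (simp add: F_def)
    then have "b = 0" by (metis kh k_0)
    with b show ?thesis by simp
  qed
  have "open (F -` S)"
    using assms(1) continuous_F by (simp add: open_vimage)
  show ?thesis
  proof (rule connectedI)
    fix A B :: "complex set"
    assume AB: "open A" "open B" "A \<inter> F -` S \<noteq> {}" "B \<inter> F -` S \<noteq> {}" "A \<inter> B \<inter> F -` S = {}"
      "F -` S \<subseteq> A \<union> B"
    have "0 \<in> A \<inter> F -` S"
      using AB \<open>open (F -` S)\<close> by (intro full[of "B \<inter> F -` S"] open_Int) auto
    moreover have "0 \<in> B \<inter> F -` S"
      using AB \<open>open (F -` S)\<close> by (intro full[of "A \<inter> F -` S"] open_Int) auto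
    ultimately show False using AB(5) by blast
  qed
qed

text \<open>A ray in \<open>E\<close> avoids \<open>c\<close>, so subtracting \<open>c\<close>
  leaves a function with a continuous square root on the contractible half-line. Applying
  \<open>k\<close> lifts the ray, and the lift is unbounded because \<open>F\<close> maps bounded
  sets to bounded sets.\<close>

lemma ray_connected_vimage_F:
  assumes E: "ray_connected_to_infinity E" and "c \<notin> E"
  shows "ray_connected_to_infinity (F -` E)"
  unfolding ray_connected_to_infinity_def
proof
  fix z assume z: "z \<in> F -` E"
  then obtain \<gamma> where \<gamma>: "continuous_on {0::real..} \<gamma>" "\<gamma> 0 = F z" "\<gamma> ` {0..} \<subseteq> E" "\<not> bounded (\<gamma> ` {0..})"
    using E unfolding ray_connected_to_infinity_def by force
  obtain g where g: "continuous_on {0::real..} g" "\<And>t. t \<in> {0..} \<Longrightarrow> \<gamma> t - c = (g t)\<^sup>2"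
  proof (rule continuous_sqrt_on_contractible[of "{0::real..}" "\<lambda>t. \<gamma> t - c"])
    show "contractible {0::real..}" by (intro convex_imp_contractible) simp
    show "continuous_on {0..} (\<lambda>t. \<gamma> t - c)" by (intro continuous_intros \<gamma>)
    show "\<gamma> t - c \<noteq> 0" if "t \<in> {0..}" for t
      using that \<gamma>(3) assms(2) by auto
  qed blast
  \<comment> \<open>The root is determined up to sign; \<open>\<sigma>\<close> is the sign for which
    the lift starts at \<open>z\<close>.\<close>
  have "(h z)\<^sup>2 = (g 0)\<^sup>2"
    using g(2)[of 0] \<gamma>(2) by (simp add: F_def)
  then have "1 * g 0 = h z \<or> (- 1) * g 0 = h z"
    by (auto simp: power2_eq_iff)
  then obtain \<sigma> :: complex where \<sigma>: "\<sigma>\<^sup>2 = 1" "\<sigma> * g 0 = h z"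
    by (metis one_power2 power2_minus)
  define \<delta> where "\<delta> t = k (\<sigma> * g t)" for t
  have F\<delta>: "F (\<delta> t) = \<gamma> t" if "t \<in> {0..}" for t
    using g(2)[OF that, symmetric] \<sigma>(1) by (simp add: \<delta>_def F_def power_mult_distrib)
  show "\<exists>\<gamma>. continuous_on {0::real..} \<gamma> \<and> \<gamma> 0 = z \<and> \<gamma> ` {0..} \<subseteq> F -` E \<and> \<not> bounded (\<gamma> ` {0..})"
  proof (intro exI[of _ \<delta>] conjI)
    show "continuous_on {0..} \<delta>"
      unfolding \<delta>_def
      by (intro continuous_on_compose2[OF cont_k] continuous_intros g) auto
    show "\<delta> 0 = z" by (simp add: \<delta>_def \<sigma>)
    show "\<delta> ` {0..} \<subseteq> F -` E" using F\<delta> \<gamma>(3) by auto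
    show "\<not> bounded (\<delta> ` {0..})"
    proof
      assume "bounded (\<delta> ` {0..})"
      then have "bounded (F ` (\<delta> ` {0..}))"
        by (metis bounded_subset closure_subset compact_closure compact_continuous_image
            compact_imp_bounded continuous_F image_mono)
      moreover have "F ` (\<delta> ` {0..}) = \<gamma> ` {0..}"
        using F\<delta> by (force simp: image_image)
      ultimately show False using \<gamma>(4) by simp
    qed
  qed
qed

text \<open>Induction carries two properties to the preimage: connectedness of \<open>U m\<close>,
  since \<open>c\<close> lies in it, and rays to infinity in its complement, since \<open>c\<close>
  does not lie there. Together they give the planar criterion that the complement has only unbounded
  components.\<close>

lemma simply_connected_U:
  assumes "\<And>m. m < n \<Longrightarrow> c \<in> U m"
  shows "simply_connected (U n)"
proof -
  have "connected (U n) \<and> ray_connected_to_infinity (- U n)"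
    using assms
  proof (induction n)
    case 0
    have "U 0 = ball 0 R" by (auto simp: U_def)
    moreover have "ray_connected_to_infinity (- ball 0 R)"
      unfolding ray_connected_to_infinity_def
    proof
      fix z :: complex assume "z \<in> - ball 0 R"
      then have z: "R \<le> cmod z" by (simp add: not_less)
      define \<gamma> where "\<gamma> t = of_real (1 + t) * z" for t
      have norm: "cmod (\<gamma> t) = (1 + t) * cmod z" if "t \<ge> 0" for t
        using that unfolding \<gamma>_def norm_mult norm_of_real by simp
      show "\<exists>\<gamma>. continuous_on {0::real..} \<gamma> \<and> \<gamma> 0 = z \<and> \<gamma> ` {0..} \<subseteq> - ball 0 R \<and> \<not> bounded (\<gamma> ` {0..})"
      proof (intro exI[of _ \<gamma>] conjI)
        show "continuous_on {0..} \<gamma>" unfolding \<gamma>_def by (intro continuous_intros)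
        show "\<gamma> 0 = z" by (simp add: \<gamma>_def)
        have "R \<le> (1 + t) * cmod z" if "t \<ge> 0" for t
          using mult_right_mono[of 1 "1 + t" "cmod z"] z that by simp
        then show "\<gamma> ` {0..} \<subseteq> - ball 0 R" using norm by (force simp: not_less)
        show "\<not> bounded (\<gamma> ` {0..})"
        proof
          assume "bounded (\<gamma> ` {0..})"
          then obtain B where B: "\<And>t. t \<ge> 0 \<Longrightarrow> cmod (\<gamma> t) \<le> B"
            unfolding bounded_iff by auto
          have "(1 + \<bar>B\<bar>) * 1 \<le> (1 + \<bar>B\<bar>) * cmod z"
            using z by (intro mult_left_mono) (auto simp: R_def intro: order_trans[rotated])
          then show False using B[of "\<bar>B\<bar>"] norm[of "\<bar>B\<bar>"] by simp
        qed
      qed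
    qed
    ultimately show ?case by simp
  next
    case (Suc n)
    then have "connected (U n)" "ray_connected_to_infinity (- U n)" "c \<in> U n" by auto
    then show ?case
      using connected_vimage_F[OF open_U, of n] ray_connected_vimage_F[of "- U n"] bounded_U[of "Suc n"]
      by (simp add: U_Suc vimage_Compl)
  qed
  then show ?thesis
    using simply_connected_eq_unbounded_complement_components[OF open_U]
      ray_connected_to_infinity_components by blast
qed

end

section \<open>Inverse branches, itineraries and cylinders\<close>

locale expanding_square_branch = expanding_square +
  fixes N :: nat and g :: "complex \<Rightarrow> complex"
  assumes cont_g: "continuous_on (U N) g"
    and g_sq: "z \<in> U N \<Longrightarrow> z - c = (g z)\<^sup>2"
begin

definition branch :: "bool \<Rightarrow> complex \<Rightarrow> complex" where
  "branch s z = k (if s then g z else - g z)"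

text \<open>Records which of the two inverse branches leads from \<open>F x\<close> back to
  \<open>x\<close>, for \<open>F x\<close> in \<open>U N\<close>.\<close>

definition digit :: "complex \<Rightarrow> bool" where
  "digit x \<longleftrightarrow> h x = g (F x)"

text \<open>Encoded as an iterated image of \<open>U N\<close> under the branches named by the first
  \<open>m\<close> digits of \<open>x\<close>, so that connectedness is inherited from
  \<open>U N\<close>.\<close>

primrec cylinder :: "complex \<Rightarrow> nat \<Rightarrow> complex set" where
  "cylinder x 0 = U N"
| "cylinder x (Suc m) = branch (digit x) ` cylinder (F x) m"

lemma F_branch: "z \<in> U N \<Longrightarrow> F (branch s z) = z"
  using g_sq[of z, symmetric] by (simp add: branch_def F_def)

lemma continuous_branch: "continuous_on (U N) (branch s)"
  unfolding branch_def
  by (cases s) (auto intro!: continuous_on_compose2[OF cont_k] continuous_intros cont_g)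

lemma branch_digit:
  assumes "F x \<in> U N"
  shows "branch (digit x) (F x) = x"
proof -
  have "(h x)\<^sup>2 = (g (F x))\<^sup>2"
    using g_sq[OF assms] by (simp add: F_def)
  then have "h x = g (F x) \<or> h x = - g (F x)"
    by (simp add: power2_eq_iff)
  then show ?thesis
    using kh[of x] unfolding branch_def digit_def by metis
qed

text \<open>Each branch is a right inverse of \<open>F\<close> and hence raises the depth by one; in
  particular the branches never leave their domain \<open>U N\<close>.\<close>

lemma cylinder_subset_U: "cylinder x m \<subseteq> U (N + m)"
proof (induction m arbitrary: x)
  case (Suc m)
  have "branch s z \<in> U (Suc (N + m))" if "z \<in> U (N + m)" for s z
    using that U_decseq[of N "N + m"] by (auto simp: U_Suc F_branch)
  then show ?case using Suc[of "F x"] by auto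
qed simp

lemma connected_cylinder:
  assumes "connected (U N)"
  shows "connected (cylinder x m)"
proof (induction m arbitrary: x)
  case (Suc m)
  have "cylinder (F x) m \<subseteq> U N"
    using cylinder_subset_U U_decseq[of N "N + m"] by force
  then show ?case
    using connected_continuous_image[OF continuous_on_subset[OF continuous_branch] Suc] by simp
qed (simp add: assms)

lemma cylinder_Suc_subset: "cylinder x (Suc m) \<subseteq> cylinder x m"
proof (induction m arbitrary: x)
  case 0
  then show ?case
    using cylinder_subset_U[of x "Suc 0"] U_decseq[of N "N + Suc 0"] by auto
next
  case (Suc m)
  then show ?case
    using image_mono[OF Suc[of "F x"]] by (simp only: cylinder.simps)
qed

lemma mem_cylinder:
  assumes "x \<in> bounded_orbit_set F"
  shows "x \<in> cylinder x m"
  using assms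
proof (induction m arbitrary: x)
  case (Suc m)
  have inv: "F x \<in> bounded_orbit_set F"
    using Suc.prems unfolding bounded_orbit_set_F by (auto simp flip: U_Suc vimage_eq)
  then have "F x \<in> U N" by (auto simp: bounded_orbit_set_F)
  then show ?case
    using Suc.IH[OF inv] branch_digit by force
qed (simp add: bounded_orbit_set_F)

lemma cylinder_cong:
  assumes "\<And>i. digit ((F ^^ i) x) = digit ((F ^^ i) y)"
  shows "cylinder x m = cylinder y m"
  using assms
proof (induction m arbitrary: x y)
  case (Suc m)
  have "digit ((F ^^ i) (F x)) = digit ((F ^^ i) (F y))" for i
    using Suc.prems[of "Suc i"] by (simp add: funpow_swap1)
  then have "cylinder (F x) m = cylinder (F y) m" by (rule Suc.IH)
  then show ?case using Suc.prems[of 0] by simp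
qed simp

text \<open>Points with equal itineraries have the same cylinders, and a nested intersection of
  compact connected sets is connected.\<close>

lemma same_itinerary_connected:
  assumes "connected (U N)" "x \<in> bounded_orbit_set F" "y \<in> bounded_orbit_set F"
    and "\<And>i. digit ((F ^^ i) x) = digit ((F ^^ i) y)"
  obtains L where "connected L" "x \<in> L" "y \<in> L" "L \<subseteq> bounded_orbit_set F"
proof
  let ?L = "\<Inter>m. closure (cylinder x m)"
  show "connected ?L"
  proof (rule connected_nest)
    show "compact (closure (cylinder x m))" for m
      using bounded_subset[OF bounded_U cylinder_subset_U] by simp
    show "connected (closure (cylinder x m))" for m
      using assms(1) by (intro connected_imp_connected_closure connected_cylinder)
    show "closure (cylinder x n) \<subseteq> closure (cylinder x m)" if "m \<le> n" for m n
      using lift_Suc_antimono_le[of "cylinder x", OF cylinder_Suc_subset that] by (rule closure_mono)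
  qed
  show "x \<in> ?L" "y \<in> ?L"
    using mem_cylinder[OF assms(2)] mem_cylinder[OF assms(3)] cylinder_cong[OF assms(4)]
      closure_subset by blast+
  have "?L \<subseteq> U m" for m
  proof -
    \<comment> \<open>Removing the closure costs one level, hence \<open>Suc m\<close>.\<close>
    have "?L \<subseteq> closure (U (N + Suc m))"
      using closure_mono[OF cylinder_subset_U[of x "Suc m"]] by blast
    also have "\<dots> \<subseteq> U (N + m)" using closure_U_Suc by simp
    also have "\<dots> \<subseteq> U m" by (rule U_decseq) simp
    finally show ?thesis .
  qed
  then show "?L \<subseteq> bounded_orbit_set F" by (auto simp: bounded_orbit_set_F)
qed

text \<open>Pigeonhole: the itinerary of a point of period \<open>n\<close> is itself
  \<open>n\<close>-periodic, so its first \<open>n\<close> digits determine it, and there are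
  \<open>2 ^ n\<close> such words.\<close>

lemma periodic_points_same_itinerary:
  assumes "P \<subseteq> periodic_points F n" "finite P" "card P > 2 ^ n" "n > 0"
  obtains x y where "x \<in> P" "y \<in> P" "x \<noteq> y" "\<And>i. digit ((F ^^ i) x) = digit ((F ^^ i) y)"
proof -
  define word where "word x = map (\<lambda>i. digit ((F ^^ i) x)) [0..<n]" for x
  have "card {xs :: bool list. set xs \<subseteq> UNIV \<and> length xs = n} = 2 ^ n"
    by (subst card_lists_length_eq) auto
  moreover have "word ` P \<subseteq> {xs. set xs \<subseteq> UNIV \<and> length xs = n}"
    by (auto simp: word_def)
  ultimately have "card (word ` P) \<le> 2 ^ n"
    using card_mono[OF finite_lists_length_eq[of "UNIV :: bool set" n]] by fastforce
  then have "\<not> inj_on word P"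
    using assms(3) card_image[of word P] by linarith
  then obtain x y where xy: "x \<in> P" "y \<in> P" "x \<noteq> y" "word x = word y"
    by (auto simp: inj_on_def)
  have "digit ((F ^^ i) x) = digit ((F ^^ i) y)" for i
  proof -
    have "digit ((F ^^ (i mod n)) x) = digit ((F ^^ (i mod n)) y)"
      using xy(4) \<open>n > 0\<close> by (auto simp: word_def)
    moreover have "(F ^^ n) x = x" "(F ^^ n) y = y"
      using xy(1,2) assms(1) by (auto simp: periodic_points_def)
    ultimately show ?thesis
      using funpow_mod_eq by metis
  qed
  with xy show ?thesis using that by blast
qed

end

section \<open>Too many periodic points exclude a totally disconnected frontier\<close>

context expanding_square
begin

theorem frontier_escaping_set_not_totally_disconnected:
  assumes "0 \<notin> bounded_orbit_set F"
    and P: "P \<subseteq> periodic_points F n" "n > 0" "finite P" "card P > 2 ^ n"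
  shows "\<not> totally_disconnected (frontier (escaping_set F))"
proof
  assume "totally_disconnected (frontier (escaping_set F))"
  then have td: "totally_disconnected (frontier (bounded_orbit_set F))"
    by (simp add: escaping_set_F frontier_complement)
  obtain j where j: "0 \<notin> U j"
    using assms(1) by (auto simp: bounded_orbit_set_F)
  have "0 \<notin> U (Suc j)"
    using j U_decseq[of j "Suc j"] by auto
  then have "c \<notin> U j" by (simp add: U_Suc)
  \<comment> \<open>Minimality puts \<open>c\<close> in all earlier sets, which makes
    \<open>U N\<close> simply connected, while \<open>c\<close> outside \<open>U N\<close> lets
    \<open>z - c\<close> have a continuous square root there.\<close>
  define N where "N = (LEAST j. c \<notin> U j)"
  have cN: "c \<notin> U N" and "\<And>m. m < N \<Longrightarrow> c \<in> U m"
    unfolding N_def using LeastI[of "\<lambda>j. c \<notin> U j", OF \<open>c \<notin> U j\<close>] not_less_Least by blast+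
  then have sc: "simply_connected (U N)" by (intro simply_connected_U) auto
  then have "\<exists>g. continuous_on (U N) g \<and> (\<forall>z\<in>U N. z - c = (g z)\<^sup>2)"
    using simply_connected_eq_continuous_sqrt[OF open_U, of N] cN
    by (auto intro!: continuous_intros elim!: allE[of _ "\<lambda>z. z - c"])
  then obtain g where "continuous_on (U N) g" "\<And>z. z \<in> U N \<Longrightarrow> z - c = (g z)\<^sup>2" by blast
  then interpret expanding_square_branch h k c N g
    by unfold_locales auto
  obtain x y where xy: "x \<in> P" "y \<in> P" "x \<noteq> y"
    and dig: "\<And>i. digit ((F ^^ i) x) = digit ((F ^^ i) y)"
    using periodic_points_same_itinerary[OF P(1,3,4,2)] by blast
  have per: "z \<in> bounded_orbit_set F" if "z \<in> P" for z
  proof -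
    have "(F ^^ n) z = z" using that P(1) by (auto simp: periodic_points_def)
    then have "(F ^^ i) z \<in> (\<lambda>i. (F ^^ i) z) ` {..<n}" for i
      using funpow_mod_eq[of n F z i] P(2) by (metis image_eqI lessThan_iff mod_less_divisor)
    \<comment> \<open>The inserted 1 makes the bound positive, as \<open>bounded_orbit_set\<close>
      demands.\<close>
    then have "cmod ((F ^^ i) z) \<le> Max (insert 1 (cmod ` (\<lambda>i. (F ^^ i) z) ` {..<n}))" for i
      by (intro Max_ge) auto
    moreover have "Max (insert 1 (cmod ` (\<lambda>i. (F ^^ i) z) ` {..<n})) \<ge> 1"
      by (intro Max_ge) auto
    ultimately show ?thesis
      unfolding bounded_orbit_set_def using less_le_trans[OF zero_less_one] by blast
  qed
  obtain L where L: "connected L" "x \<in> L" "y \<in> L" "L \<subseteq> bounded_orbit_set F"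
    using same_itinerary_connected[OF simply_connected_imp_connected[OF sc] per per dig] xy by blast
  have "bounded (bounded_orbit_set F)"
    unfolding bounded_orbit_set_F by (rule bounded_subset[OF bounded_U[of 0]]) blast
  then have "interior (bounded_orbit_set F) = {}"
    using td by (intro interior_empty_if_totally_disconnected_frontier) auto
  then have "bounded_orbit_set F \<subseteq> frontier (bounded_orbit_set F)"
    using closure_subset by (auto simp: frontier_def)
  then show False
    using totally_disconnected_connected_subset[OF td L(1) _ L(2,3)] L(4) xy(3) by blast
qed

end

section \<open>Application to \<open>H\<close>\<close>

text \<open>The real-linear map \<open>h\<close> has determinant \<open>a * a - b * b = K\<close>
  and shrinks no vector, since \<open>cmod (h z) >= (a - b) * cmod z\<close> with
  \<open>a - b = 1\<close>.\<close>

lemma H_expanding_square: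
  fixes K \<theta> :: real and c :: complex
  assumes "K \<ge> 1"
  obtains h k where "expanding_square h k" "H K \<theta> c = expanding_square.F h c"
proof -
  define a where "a = (K + 1) / 2"
  define b where "b = (K - 1) / 2"
  define u where "u = exp (2 * \<i> * of_real \<theta>)"
  define h where "h z = of_real a * z + u * of_real b * cnj z" for z
  \<comment> \<open>Obtained by eliminating \<open>cnj z\<close> from \<open>w = h z\<close> and its
    conjugate, using \<open>u * cnj u = 1\<close>.\<close>
  define k where "k w = (of_real a * w - u * of_real b * cnj w) / of_real K" for w
  have u: "cmod u = 1"
    unfolding u_def by (metis mult.assoc mult.commute norm_exp_i_times of_real_mult of_real_numeral)
  then have uu: "u * cnj u = 1"
    by (simp add: complex_norm_square[symmetric])
  have ab: "a * a - b * b = K"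
    by (simp add: a_def b_def field_simps)
  have "expanding_square h k"
  proof
    show "continuous_on UNIV h" "continuous_on UNIV k"
      unfolding h_def k_def using assms by (auto intro!: continuous_intros)
    fix z
    have "\<bar>a\<bar> = a" "\<bar>b\<bar> = b" using assms by (simp_all add: a_def b_def)
    then have "a * cmod z - b * cmod z \<le> cmod (h z)"
      unfolding h_def
      using norm_diff_ineq[of "of_real a * z" "u * of_real b * cnj z"] u
      by (simp add: norm_mult)
    moreover have "a - b = 1" by (simp add: a_def b_def field_simps)
    ultimately show "cmod z \<le> cmod (h z)"
      by (metis left_diff_distrib mult_1)
    have cab: "complex_of_real a * of_real a - of_real b * of_real b = of_real K"
      using ab by (metis of_real_diff of_real_mult)
    have [simp]: "K \<noteq> 0" using assms by simp
    have "of_real K * h (k z) = of_real K * z"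
    proof -
      have "of_real K * h (k z) = (of_real a * of_real a - (u * cnj u) * (of_real b * of_real b)) * z"
        by (simp add: h_def k_def field_simps)
      then show ?thesis using cab uu by simp
    qed
    then show "h (k z) = z" by simp
    have "of_real K * k (h z) = (of_real a * of_real a - (u * cnj u) * (of_real b * of_real b)) * z"
      by (simp add: h_def k_def field_simps)
    then have "of_real K * k (h z) = of_real K * z" using cab uu by simp
    then show "k (h z) = z" by simp
  qed
  moreover have "H K \<theta> c = expanding_square.F h c"
    using expanding_square.F_def[OF calculation]
    by (auto simp: H_def h_def a_def b_def u_def)
  ultimately show ?thesis by (rule that)
qed

theorem theorem1p3:
  fixes K \<theta> :: real and c :: complex
  assumes "K > 1"
    and "\<theta> \<in> {-pi/2<..pi/2}"
    and "c \<notin> mandelbrot_set K \<theta>"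
    and "\<exists>n\<ge>1. \<exists>P. P \<subseteq> periodic_points (H K \<theta> c) n \<and> finite P \<and> card P \<ge> 2 ^ n + 1"
  shows "\<not> cantor_set (frontier (escaping_set (H K \<theta> c)))"
proof -
  obtain h k where hk: "expanding_square h k" and H: "H K \<theta> c = expanding_square.F h c"
    using assms(1) by (elim H_expanding_square[OF less_imp_le])
  obtain n P where "n \<ge> 1" "P \<subseteq> periodic_points (H K \<theta> c) n" "finite P" "card P \<ge> 2 ^ n + 1"
    using assms(4) by blast
  then have "\<not> totally_disconnected (frontier (escaping_set (H K \<theta> c)))"
    using expanding_square.frontier_escaping_set_not_totally_disconnected[OF hk, of c P n]
      assms(3) by (simp add: H mandelbrot_set_def)
  then show ?thesis by (simp add: cantor_set_def)
qed

end
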